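(* There exists a distribution $F$ supported on $[0,\infty)$ such that $F\in\mathcal{S}_{loc}$ but the local distribution of $F$ is not almost decreased; that is, for every $0<d<\infty$ there is no constant $x_0>0$ for which $$\sup_{x_0\le x\le y<\infty}\frac{F(y+\Delta_d)}{F(x+\Delta_d)}<\infty .$$
   Context: For a distribution $F$ on $[0,\infty)$ put $F(x+\Delta_d)=F(x+d)-F(x)$ for $0<d<\infty$ and $F(x+\Delta_\infty)=1-F(x)$. $a(x)\sim b(x)$ means $a(x)/b(x)\to1$ as $x\to\infty$. $F\in\mathcal L_{loc}$ if for all $d\in(0,\infty]$: $F(x+\Delta_d)>0$ for all large $x$, and for any $t>0$, $F(x+s+\Delta_d)\sim F(x+\Delta_d)$ uniformly for all $|s|\le t$. $F\in\mathcal S_{loc}$ if $F\in\mathcal L_{loc}$ and, for all $d\in(0,\infty]$, $F^{*2}(x+\Delta_d)\sim 2F(x+\Delta_d)$, where $F^{*2}$ is the convolution of $F$ with itself. The local distribution of $F$ is called almost decreased if $\sup_{x_0\le x\le y<\infty}F(y+\Delta_d)/F(x+\Delta_d)<\infty$ for some positive constant $x_0$. *)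

theory Defs
  imports "HOL-Probability.Probability" "HOL-Library.Landau_Symbols"
begin

text \<open>
  A distribution is represented by its Borel probability measure \<open>M\<close> on the reals; the
  distribution function \<open>F(x)\<close> of the text is \<open>cdf M x\<close>, and the convolution \<open>F\<^sup>*\<^sup>2\<close> is \<open>M \<star> M\<close>.
\<close>

definition distribution_on_nonneg :: "real measure \<Rightarrow> bool" where
  "distribution_on_nonneg M \<longleftrightarrow> real_distribution M \<and> measure M {..<0} = 0"

text \<open>\<open>F(x + \<Delta>\<^sub>d)\<close>; only \<open>0 < d\<close> is meaningful.\<close>

definition local_prob :: "real measure \<Rightarrow> ereal \<Rightarrow> real \<Rightarrow> real" where
  "local_prob M d x =
     (if d = \<infinity> then 1 - cdf M x else cdf M (x + real_of_ereal d) - cdf M x)"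

definition L_loc :: "real measure \<Rightarrow> bool" where
  "L_loc M \<longleftrightarrow> distribution_on_nonneg M \<and>
     (\<forall>d::ereal. 0 < d \<longrightarrow>
        (\<forall>\<^sub>F x in at_top. local_prob M d x > 0) \<and>
        (\<forall>t::real. 0 < t \<longrightarrow>
           uniform_limit {s. \<bar>s\<bar> \<le> t}
             (\<lambda>x s. local_prob M d (x + s) / local_prob M d x) (\<lambda>_. 1) at_top))"

text \<open>
  By the positivity part of \<open>L_loc\<close>, the library's convention that \<open>0\<close> and \<open>0\<close> are
  asymptotically equivalent plays no role in the following definition.
\<close>

definition S_loc :: "real measure \<Rightarrow> bool" where
  "S_loc M \<longleftrightarrow> L_loc M \<and>
     (\<forall>d::ereal. 0 < d \<longrightarrow>
        local_prob (M \<star> M) d \<sim>[at_top] (\<lambda>x. 2 * local_prob M d x))"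

text \<open>
  The quotient is formed in \<^typ>\<open>ereal\<close>, where \<open>a / 0 = \<infinity>\<close> for \<open>a > 0\<close>, so that a vanishing
  denominator is not read as a vanishing quotient.
\<close>

definition almost_decreased :: "real measure \<Rightarrow> ereal \<Rightarrow> bool" where
  "almost_decreased M d \<longleftrightarrow>
     (\<exists>x0::real. 0 < x0 \<and>
        (SUP (x, y) \<in> {(x, y). x0 \<le> x \<and> x \<le> y}.
           ereal (local_prob M d y) / ereal (local_prob M d x)) < \<infinity>)"

end

theory Submission
  imports Defs
begin

text \<open>
  Write a density as \<open>p x = exp (- \<phi> (ln (1 + x)))\<close>. If \<open>\<phi>\<close> is Lipschitz, then \<open>p\<close> is long-tailed
  and \<open>p z \<le> C * p x\<close> for \<open>x / 2 \<le> z \<le> x\<close>; after folding the convolution integral of \<open>p\<close> with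
  itself at \<open>x / 2\<close>, dominated convergence shows that it is asymptotic to \<open>2 * p x\<close>, and integrating
  over \<open>(x, x + d]\<close> gives membership in \<open>S_loc\<close>. A Lipschitz \<open>\<phi>\<close> may still decrease by arbitrarily
  large amounts: \<open>\<phi> u = 2 * u + 3 * dist (u, {4 ^ k | k})\<close> drops by at least \<open>4 ^ k\<close> between
  \<open>3 * 4 ^ k\<close> and \<open>4 ^ (k + 1)\<close>.
\<close>

section \<open>Local probabilities\<close>

text \<open>Adding \<open>d\<close> in \<open>ereal\<close> puts bounded windows and the tail into
  one family, so that later estimates treat all \<open>d\<close> at once.\<close>

definition window :: "ereal \<Rightarrow> real \<Rightarrow> real set" where
  "window d x = {v. x < v \<and> ereal v \<le> ereal x + d}"

lemma window_infinity: "window \<infinity> x = {x<..}"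
  by (auto simp: window_def)

lemma window_ereal: "window (ereal d) x = {x<..x + d}"
  by (auto simp: window_def)

lemma window_eq:
  assumes "0 < d"
  obtains "d = \<infinity>" "window d = (\<lambda>x. {x<..})"
  | r where "0 < r" "d = ereal r" "window d = (\<lambda>x. {x<..x + r})"
  using assms by (cases d) (auto simp: window_infinity window_ereal fun_eq_iff)

lemma window_measurable [measurable]: "window d x \<in> sets borel"
  unfolding window_def by measurable

lemma mem_window_shift: "v + s \<in> window d (x + s) \<longleftrightarrow> v \<in> window d x"
  by (cases d) (auto simp: window_def)

lemma window_gt: "v \<in> window d x \<Longrightarrow> x < v"
  by (simp add: window_def)

lemma local_prob_eq_measure_window:
  assumes "real_distribution M" "0 < d"
  shows "local_prob M d x = measure M (window d x)"
proof -
  interpret real_distribution M by fact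
  show ?thesis
    using \<open>0 < d\<close>
  proof (cases rule: window_eq)
    case 1
    have "measure M {x<..} = measure M (space M - {..x})"
      by (rule arg_cong[of _ _ "measure M"]) auto
    also have "\<dots> = 1 - cdf M x"
      unfolding cdf_def by (rule prob_compl) simp
    finally show ?thesis
      using 1 by (simp add: local_prob_def)
  next
    case (2 r)
    then show ?thesis
      using cdf_diff_eq[of x "x + r"] by (simp add: local_prob_def)
  qed
qed

text \<open>This turns pointwise bounds between densities into bounds between masses. Finiteness of
  the dominating measure matters because \<open>measure\<close> reads an infinite mass as 0.\<close>

lemma measure_density_le:
  fixes u v :: "real \<Rightarrow> ennreal"
  assumes [measurable]: "u \<in> borel_measurable borel" "v \<in> borel_measurable borel" "A \<in> sets borel"
    and fin: "finite_measure (density lborel v)"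
    and "0 \<le> K" and le: "\<And>x. x \<in> A \<Longrightarrow> u x \<le> ennreal K * v x"
  shows "measure (density lborel u) A \<le> K * measure (density lborel v) A"
proof -
  have "emeasure (density lborel u) A = (\<integral>\<^sup>+x. u x * indicator A x \<partial>lborel)"
    by (simp add: emeasure_density)
  also have "\<dots> \<le> (\<integral>\<^sup>+x. ennreal K * (v x * indicator A x) \<partial>lborel)"
    by (intro nn_integral_mono) (auto simp: le split: split_indicator)
  also have "\<dots> = ennreal K * emeasure (density lborel v) A"
    by (simp add: emeasure_density nn_integral_cmult)
  also have "\<dots> = ennreal (K * measure (density lborel v) A)"
    using \<open>0 \<le> K\<close> by (simp add: finite_measure.emeasure_eq_measure[OF fin] ennreal_mult)
  finally show ?thesis
    unfolding measure_def using \<open>0 \<le> K\<close>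
    by (metis enn2real_leI enn2real_nonneg mult_nonneg_nonneg)
qed

text \<open>Two upper bounds suffice, since \<open>b \<le> (1 + e) * a\<close> forces
  \<open>a / b \<ge> 1 / (1 + e) \<ge> 1 - e\<close>. Hence every limit below is proved from upper
  bounds only.\<close>

lemma dist_ratio_one_le:
  fixes a b e :: real
  assumes "0 < e" "0 < b" "a \<le> (1 + e) * b" "b \<le> (1 + e) * a"
  shows "dist (a / b) 1 \<le> e"
proof -
  have "0 < a"
    using assms(1) less_le_trans[OF assms(2,4)] by (simp add: zero_less_mult_iff)
  have "(1 - e) * b \<le> a"
  proof (cases "e < 1")
    case True
    have "(1 - e) * b \<le> (1 - e) * ((1 + e) * a)"
      using assms True by (intro mult_left_mono) auto
    also have "\<dots> \<le> a"
      using \<open>0 < a\<close> by (simp add: algebra_simps)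
    finally show ?thesis .
  next
    case False
    then have "(1 - e) * b \<le> 0"
      using \<open>0 < b\<close> by (intro mult_nonpos_nonneg) auto
    then show ?thesis
      using \<open>0 < a\<close> by simp
  qed
  then show ?thesis
    using assms by (simp add: dist_real_def abs_le_iff field_simps)
qed

section \<open>Long-tailed densities of dominated variation\<close>

text \<open>\<open>long_tailed\<close> is one-sided because the matching lower bound follows by
  shifting back from \<open>x + s\<close> by \<open>- s\<close>. \<open>dominated\<close> supplies
  the integrable majorant for the folded convolution.\<close>

locale long_tailed_density =
  fixes p :: "real \<Rightarrow> real" and C :: real
  assumes borel_p [measurable]: "p \<in> borel_measurable borel"
    and p_neg: "\<And>x. x < 0 \<Longrightarrow> p x = 0"
    and p_pos: "\<And>x. 0 \<le> x \<Longrightarrow> 0 < p x"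
    and nn_integral_p: "(\<integral>\<^sup>+x. ennreal (p x) \<partial>lborel) = 1"
    and long_tailed: "\<And>t e. 0 < t \<Longrightarrow> 0 < e \<Longrightarrow>
      \<forall>\<^sub>F x in at_top. \<forall>s. \<bar>s\<bar> \<le> t \<longrightarrow> p (x + s) \<le> (1 + e) * p x"
    and dominated: "\<And>x z. 0 \<le> x \<Longrightarrow> x / 2 \<le> z \<Longrightarrow> z \<le> x \<Longrightarrow> p z \<le> C * p x"
begin

definition distr_p :: "real measure" where
  "distr_p = density lborel (\<lambda>x. ennreal (p x))"

lemma p_nonneg: "0 \<le> p x"
  by (metis less_eq_real_def linorder_not_le p_neg p_pos)

lemma real_distribution_distr_p: "real_distribution distr_p"
  unfolding distr_p_def real_distribution_def real_distribution_axioms_def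
  by (auto intro!: prob_spaceI simp: emeasure_density nn_integral_p)

lemma finite_measure_distr_p: "finite_measure distr_p"
  using real_distribution_distr_p by (simp add: real_distribution_def prob_space_def)

lemma distribution_on_nonneg_distr_p: "distribution_on_nonneg distr_p"
proof -
  have "emeasure distr_p {..<0} = (\<integral>\<^sup>+x. ennreal (p x) * indicator {..<0} x \<partial>lborel)"
    unfolding distr_p_def by (simp add: emeasure_density)
  also have "\<dots> = (\<integral>\<^sup>+(x::real). 0 \<partial>lborel)"
    by (intro nn_integral_cong) (auto simp: p_neg split: split_indicator)
  finally show ?thesis
    by (simp add: distribution_on_nonneg_def real_distribution_distr_p measure_def)
qed

lemma integrable_p: "integrable lborel p"
  by (rule integrableI_nn_integral_finite[where x = 1]) (simp_all add: p_nonneg nn_integral_p)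

lemma integral_p: "(\<integral>x. p x \<partial>lborel) = 1"
  by (rule integral_eq_nn_integral[THEN trans]) (simp_all add: p_nonneg nn_integral_p)

section \<open>Window masses under shifts, and long-tailedness of the local distribution\<close>

lemma measure_window_pos:
  assumes "0 < d" "0 \<le> x"
  shows "0 < measure distr_p (window d x)"
proof (rule ccontr)
  assume "\<not> ?thesis"
  then have "emeasure distr_p (window d x) = 0"
    by (simp add: finite_measure.emeasure_eq_measure[OF finite_measure_distr_p] ennreal_neg)
  then have "AE v in lborel. ennreal (p v) * indicator (window d x) v = 0"
    unfolding distr_p_def
    by (subst (asm) emeasure_density, simp, simp, subst (asm) nn_integral_0_iff_AE) auto
  \<comment> \<open>The density is positive on the whole window, so a window of mass zero would be a
    Lebesgue null set.\<close>
  then have "AE v in lborel. v \<notin> window d x"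
  proof eventually_elim
    case (elim v)
    show ?case
    proof
      assume "v \<in> window d x"
      moreover from this have "0 < p v"
        using window_gt \<open>0 \<le> x\<close> by (intro p_pos) force
      ultimately show False
        using elim by simp
    qed
  qed
  then have null: "emeasure lborel (window d x) = 0"
    by (subst (asm) AE_iff_measurable[OF _ refl]) auto
  show False
    using \<open>0 < d\<close>
  proof (cases rule: window_eq)
    case 1
    have "emeasure lborel {x<..x+1} \<le> emeasure lborel {x<..}"
      by (intro emeasure_mono) auto
    then show ?thesis
      using 1 null by simp
  next
    case (2 r)
    then show ?thesis
      using null by simp
  qed
qed

text \<open>Translation by \<open>s\<close> carries one window onto the other, so both masses become
  integrals over \<open>window d x\<close>, where the integrands are compared pointwise.\<close>

lemma measure_window_shift_le:
  assumes "0 \<le> K" and "\<And>v. v > x \<Longrightarrow> p (v + s) \<le> K * p v"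
  shows "measure distr_p (window d (x + s)) \<le> K * measure distr_p (window d x)"
proof -
  have "emeasure distr_p (window d (x + s)) =
      (\<integral>\<^sup>+v. ennreal (p v) * indicator (window d (x + s)) v \<partial>lborel)"
    unfolding distr_p_def by (simp add: emeasure_density)
  also have "\<dots> = (\<integral>\<^sup>+v. ennreal (p (s + 1 * v)) * indicator (window d (x + s)) (s + 1 * v) \<partial>lborel)"
    by (subst nn_integral_real_affine[where c = 1 and t = s]) auto
  also have "\<dots> = (\<integral>\<^sup>+v. ennreal (p (v + s)) * indicator (window d x) v \<partial>lborel)"
    by (intro nn_integral_cong)
       (auto simp: mem_window_shift add.commute[of s] split: split_indicator)
  also have "\<dots> = emeasure (density lborel (\<lambda>v. ennreal (p (v + s)))) (window d x)"
    by (simp add: emeasure_density)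
  finally have "measure distr_p (window d (x + s)) =
      measure (density lborel (\<lambda>v. ennreal (p (v + s)))) (window d x)"
    by (simp add: measure_def)
  also have "\<dots> \<le> K * measure distr_p (window d x)"
    unfolding distr_p_def
    using assms finite_measure_distr_p window_gt
    by (intro measure_density_le)
       (auto simp: distr_p_def ennreal_mult[symmetric] p_nonneg intro!: ennreal_leI)
  finally show ?thesis .
qed

text \<open>The bound in \<open>long_tailed\<close> is uniform in \<open>s\<close> and survives
  integration over any window with the same constant.\<close>

lemma L_loc_distr_p: "L_loc distr_p"
  unfolding L_loc_def
proof (intro conjI allI impI distribution_on_nonneg_distr_p)
  fix d :: ereal assume d: "0 < d"
  note lp = local_prob_eq_measure_window[OF real_distribution_distr_p d]
  show "\<forall>\<^sub>F x in at_top. 0 < local_prob distr_p d x"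
    using eventually_ge_at_top[of 0] by eventually_elim (simp add: lp measure_window_pos d)
  fix t :: real assume "0 < t"
  show "uniform_limit {s. \<bar>s\<bar> \<le> t}
      (\<lambda>x s. local_prob distr_p d (x + s) / local_prob distr_p d x) (\<lambda>_. 1) at_top"
  proof (rule uniform_limitI)
    fix e :: real assume "0 < e"
    then obtain X where X: "\<And>x s. X \<le> x \<Longrightarrow> \<bar>s\<bar> \<le> t \<Longrightarrow> p (x + s) \<le> (1 + e / 2) * p x"
      using long_tailed[OF \<open>0 < t\<close>, of "e / 2"] by (auto simp: eventually_at_top_linorder)
    have le: "measure distr_p (window d (x + s)) \<le> (1 + e / 2) * measure distr_p (window d x)"
      if "X \<le> x" "\<bar>s\<bar> \<le> t" for x s
      using that \<open>0 < e\<close> by (intro measure_window_shift_le X) auto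
    show "\<forall>\<^sub>F x in at_top. \<forall>s\<in>{s. \<bar>s\<bar> \<le> t}.
        dist (local_prob distr_p d (x + s) / local_prob distr_p d x) 1 < e"
      \<comment> \<open>The extra \<open>t\<close> keeps \<open>x + s\<close> beyond
        \<open>X\<close>, so that the bound also applies to the shift back by
        \<open>- s\<close>.\<close>
      using eventually_ge_at_top[of "max X 0 + t"]
    proof eventually_elim
      case (elim x)
      show ?case
      proof
        fix s assume "s \<in> {s. \<bar>s\<bar> \<le> t}"
        then have s: "\<bar>s\<bar> \<le> t" "\<bar>- s\<bar> \<le> t" "X \<le> x + s" "X \<le> x" "0 \<le> x"
          using elim by auto
        have "dist (local_prob distr_p d (x + s) / local_prob distr_p d x) 1 \<le> e / 2"
          unfolding lp using \<open>0 < e\<close> le[of x s] le[of "x + s" "- s"] s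
          by (intro dist_ratio_one_le measure_window_pos d) auto
        then show "dist (local_prob distr_p d (x + s) / local_prob distr_p d x) 1 < e"
          using \<open>0 < e\<close> by simp
      qed
    qed
  qed
qed

section \<open>The density of the convolution square and its asymptotics\<close>

definition self_conv :: "real \<Rightarrow> ennreal" where
  "self_conv x = (\<integral>\<^sup>+y. ennreal (p (x - y)) * ennreal (p y) \<partial>lborel)"

text \<open>A Bochner integral of reals is used here so that dominated convergence applies; the
  nonnegative integral \<open>self_conv\<close> is linked to it in
  \<open>self_conv_eq\<close>.\<close>

definition half_conv_ratio :: "real \<Rightarrow> real" where
  "half_conv_ratio x = (\<integral>y. p (x - y) * p y * indicator {..x / 2} y / p x \<partial>lborel)"

lemma self_conv_measurable [measurable]: "self_conv \<in> borel_measurable borel"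
  unfolding self_conv_def by measurable

lemma convolution_distr_p: "distr_p \<star> distr_p = density lborel self_conv"
  unfolding distr_p_def self_conv_def
  using finite_measure_distr_p by (intro convolution_density) (auto simp: distr_p_def)

text \<open>The reflection of \<open>y\<close> to \<open>x - y\<close> preserves the integrand and
  exchanges the two sides of \<open>x / 2\<close>.\<close>

lemma self_conv_fold:
  "self_conv x = 2 * (\<integral>\<^sup>+y. ennreal (p (x - y) * p y * indicator {..x / 2} y) \<partial>lborel)"
proof -
  have "self_conv x = (\<integral>\<^sup>+y. ennreal (p (x - y) * p y * indicator {..x / 2} y)
      + ennreal (p (x - y) * p y * indicator {x / 2<..} y) \<partial>lborel)"
    unfolding self_conv_def
    by (intro nn_integral_cong) (auto simp: ennreal_mult p_nonneg split: split_indicator)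
  also have "\<dots> = (\<integral>\<^sup>+y. ennreal (p (x - y) * p y * indicator {..x / 2} y) \<partial>lborel)
      + (\<integral>\<^sup>+y. ennreal (p (x - y) * p y * indicator {x / 2<..} y) \<partial>lborel)"
    by (rule nn_integral_add) auto
  also have "(\<integral>\<^sup>+y. ennreal (p (x - y) * p y * indicator {x / 2<..} y) \<partial>lborel)
      = (\<integral>\<^sup>+y. ennreal (p (x - (x + -1 * y)) * p (x + -1 * y)
          * indicator {x / 2<..} (x + -1 * y)) \<partial>lborel)"
    by (subst nn_integral_real_affine[where c = "-1" and t = x]) auto
  also have "\<dots> = (\<integral>\<^sup>+y. ennreal (p (x - y) * p y * indicator {..x / 2} y) \<partial>lborel)"
    \<comment> \<open>The reflected half is \<open>{..<x / 2}\<close>, which misses only the null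
      set \<open>{x / 2}\<close>.\<close>
    using AE_lborel_singleton[of "x / 2"]
    by (intro nn_integral_cong_AE, eventually_elim) (auto simp: mult.commute split: split_indicator)
  finally show ?thesis
    by (simp add: mult_2)
qed

text \<open>For \<open>0 \<le> y \<le> x / 2\<close> the point \<open>x - y\<close> lies between
  \<open>x / 2\<close> and \<open>x\<close>, where \<open>dominated\<close> applies; elsewhere the
  left side vanishes. The majorant does not depend on \<open>x\<close>.\<close>

lemma half_conv_bound:
  assumes "0 \<le> x"
  shows "norm (p (x - y) * p y * indicator {..x / 2} y / p x) \<le> C * p y"
proof (cases "0 \<le> y \<and> y \<le> x / 2")
  case True
  then have "p (x - y) \<le> C * p x"
    using assms by (intro dominated) auto
  then have "p (x - y) * p y \<le> C * p x * p y"
    by (rule mult_right_mono) (rule p_nonneg)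
  then show ?thesis
    using True p_pos[OF assms] by (simp add: p_nonneg abs_mult field_simps)
next
  case False
  \<comment> \<open>The sign of \<open>C\<close> is hidden in \<open>dominated\<close>: the case
    \<open>x = z = 0\<close> yields it.\<close>
  have "p 0 \<le> C * p 0"
    by (rule dominated) auto
  then have "0 \<le> C"
    using p_pos[of 0] by (simp add: mult_le_cancel_right1)
  then show ?thesis
    using False p_neg[of y] by (auto simp: p_nonneg not_le indicator_def)
qed

lemma self_conv_eq:
  assumes "0 \<le> x"
  shows "self_conv x = ennreal (2 * half_conv_ratio x * p x)"
proof -
  note pos = p_pos[OF assms]
  let ?g = "\<lambda>y. p (x - y) * p y * indicator {..x / 2} y / p x"
  have int: "integrable lborel ?g"
    by (rule Bochner_Integration.integrable_bound[where f = "\<lambda>y. C * p y"])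
       (use integrable_p order_trans[OF half_conv_bound[OF assms] abs_ge_self] in auto)
  have nn: "0 \<le> ?g y" for y
    by (simp add: p_nonneg)
  have "(\<integral>\<^sup>+y. ennreal (p (x - y) * p y * indicator {..x / 2} y) \<partial>lborel)
      = (\<integral>\<^sup>+y. ennreal (p x) * ennreal (?g y) \<partial>lborel)"
    using pos by (intro nn_integral_cong) (simp add: ennreal_mult[symmetric] p_nonneg)
  also have "\<dots> = ennreal (p x) * (\<integral>\<^sup>+y. ennreal (?g y) \<partial>lborel)"
    by (rule nn_integral_cmult) simp
  also have "(\<integral>\<^sup>+y. ennreal (?g y) \<partial>lborel) = ennreal (half_conv_ratio x)"
    unfolding half_conv_ratio_def by (rule nn_integral_eq_integral[OF int]) (simp add: nn)
  finally have "self_conv x = ennreal 2 * (ennreal (p x) * ennreal (half_conv_ratio x))"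
    unfolding self_conv_fold by simp
  moreover have "0 \<le> half_conv_ratio x"
    unfolding half_conv_ratio_def by (rule Bochner_Integration.integral_nonneg) (rule nn)
  ultimately show ?thesis
    using pos by (simp add: ennreal_mult[symmetric] mult_ac del: ennreal_numeral)
qed

lemma p_shift_ratio_tendsto: "((\<lambda>x. p (x - y) / p x) \<longlongrightarrow> 1) at_top"
proof (rule tendstoI)
  fix e :: real assume "0 < e"
  \<comment> \<open>Adding 1 keeps the shift bound positive when \<open>y = 0\<close>.\<close>
  let ?t = "\<bar>y\<bar> + 1"
  obtain X where X: "\<And>x s. X \<le> x \<Longrightarrow> \<bar>s\<bar> \<le> ?t \<Longrightarrow> p (x + s) \<le> (1 + e / 2) * p x"
    using long_tailed[of ?t "e / 2"] \<open>0 < e\<close>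
    by (fastforce simp: eventually_at_top_linorder)
  show "\<forall>\<^sub>F x in at_top. dist (p (x - y) / p x) 1 < e"
    using eventually_ge_at_top[of "max X 0 + ?t"]
  proof eventually_elim
    case (elim x)
    have "dist (p (x - y) / p x) 1 \<le> e / 2"
      using X[of x "- y"] X[of "x - y" y] elim \<open>0 < e\<close>
      by (intro dist_ratio_one_le p_pos) auto
    then show ?case
      using \<open>0 < e\<close> by simp
  qed
qed

text \<open>For fixed \<open>y\<close> the integrand tends to \<open>p y\<close>, because the shift
  ratio tends to 1 and the indicator equals 1 once \<open>x \<ge> 2 * y\<close>. Dominated
  convergence then gives the total mass of \<open>p\<close>.\<close>

lemma half_conv_ratio_tendsto: "(half_conv_ratio \<longlongrightarrow> 1) at_top"
proof -
  have "((\<lambda>x. \<integral>y. p (x - y) * p y * indicator {..x / 2} y / p x \<partial>lborel)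
      \<longlongrightarrow> (\<integral>y. p y \<partial>lborel)) at_top"
  proof (rule integral_dominated_convergence_at_top[where w = "\<lambda>y. C * p y"])
    show "\<forall>\<^sub>F x in at_top. AE y in lborel.
        norm (p (x - y) * p y * indicator {..x / 2} y / p x) \<le> C * p y"
      using eventually_ge_at_top[of 0] by eventually_elim (simp add: half_conv_bound del: real_norm_def)
    have "((\<lambda>x. p (x - y) * p y * indicator {..x / 2} y / p x) \<longlongrightarrow> p y) at_top" for y
    proof (rule Lim_transform_eventually)
      show "((\<lambda>x. p (x - y) / p x * p y) \<longlongrightarrow> p y) at_top"
        using tendsto_mult_right[OF p_shift_ratio_tendsto] by (rule tendsto_eq_rhs) simp
      show "\<forall>\<^sub>F x in at_top.
          p (x - y) / p x * p y = p (x - y) * p y * indicator {..x / 2} y / p x"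
        using eventually_ge_at_top[of "2 * y"] by eventually_elim simp
    qed
    then show "AE y in lborel.
        ((\<lambda>x. p (x - y) * p y * indicator {..x / 2} y / p x) \<longlongrightarrow> p y) at_top"
      by simp
  qed (use integrable_p in auto)
  then show ?thesis
    unfolding half_conv_ratio_def integral_p .
qed

text \<open>Every point of a window exceeds its left end, so far out \<open>self_conv\<close> is
  nearly \<open>2 * p\<close> on the entire window, and the comparison passes to the masses for
  bounded and unbounded windows alike.\<close>

lemma S_loc_distr_p: "S_loc distr_p"
  unfolding S_loc_def
proof (intro conjI allI impI L_loc_distr_p)
  fix d :: ereal assume d: "0 < d"
  note lp = local_prob_eq_measure_window[OF real_distribution_distr_p d]
  have "prob_space (distr_p \<star> distr_p)"
    unfolding convolution_distr_p self_conv_def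
    using real_distribution_distr_p
    by (intro prob_space_convolution_density) (auto simp: distr_p_def real_distribution_def)
  then have rd: "real_distribution (distr_p \<star> distr_p)"
    by (simp add: real_distribution_def real_distribution_axioms_def)
  then have fin: "finite_measure (density lborel self_conv)"
    by (simp add: real_distribution_def prob_space_def convolution_distr_p)
  note lq = local_prob_eq_measure_window[OF rd d]
  have "((\<lambda>x. local_prob (distr_p \<star> distr_p) d x / (2 * local_prob distr_p d x)) \<longlongrightarrow> 1) at_top"
  proof (rule tendstoI)
    fix e :: real assume "0 < e"
    \<comment> \<open>Bounding the ratio between \<open>1 / c\<close> and \<open>c\<close> gives the
      two inequalities of \<open>dist_ratio_one_le\<close> with error \<open>e / 2\<close>.\<close>
    define c where "c = 1 + e / 2"
    have "1 < c"
      using \<open>0 < e\<close> by (simp add: c_def)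
    then have "1 / c < 1"
      by simp
    then obtain X where X: "\<And>x. X \<le> x \<Longrightarrow> half_conv_ratio x \<le> c"
        "\<And>x. X \<le> x \<Longrightarrow> 1 / c \<le> half_conv_ratio x"
      using order_tendstoD[OF half_conv_ratio_tendsto, of c]
        order_tendstoD[OF half_conv_ratio_tendsto, of "1 / c"] \<open>1 < c\<close>
      unfolding eventually_at_top_linorder by (metis less_imp_le linorder_le_cases order_trans)
    show "\<forall>\<^sub>F x in at_top.
        dist (local_prob (distr_p \<star> distr_p) d x / (2 * local_prob distr_p d x)) 1 < e"
      using eventually_ge_at_top[of "max X 0"]
    proof eventually_elim
      case (elim x)
      let ?W = "window d x"
      have W: "X \<le> v" "0 \<le> v" if "v \<in> ?W" for v
        using window_gt[OF that] elim by auto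
      have "measure (density lborel self_conv) ?W \<le> 2 * c * measure distr_p ?W"
        unfolding distr_p_def
      proof (rule measure_density_le)
        fix v assume "v \<in> ?W"
        then have "2 * half_conv_ratio v * p v \<le> 2 * c * p v"
          using W X by (intro mult_right_mono p_nonneg) auto
        then show "self_conv v \<le> ennreal (2 * c) * ennreal (p v)"
          using \<open>1 < c\<close> W[OF \<open>v \<in> ?W\<close>]
          by (simp add: self_conv_eq ennreal_mult[symmetric] p_nonneg ennreal_leI)
      qed (use finite_measure_distr_p \<open>1 < c\<close> in \<open>auto simp: distr_p_def\<close>)
      moreover have "measure distr_p ?W \<le> c / 2 * measure (density lborel self_conv) ?W"
        unfolding distr_p_def
      proof (rule measure_density_le)
        fix v assume "v \<in> ?W"
        then have "1 / c \<le> half_conv_ratio v"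
          using W X by auto
        then have "1 \<le> c * half_conv_ratio v"
          using \<open>1 < c\<close> by (simp add: field_simps)
        then have "1 * p v \<le> c * half_conv_ratio v * p v"
          by (intro mult_right_mono p_nonneg)
        also have "\<dots> = c / 2 * (2 * half_conv_ratio v * p v)"
          by simp
        finally have "ennreal (p v) \<le> ennreal (c / 2 * (2 * half_conv_ratio v * p v))"
          by (simp add: ennreal_leI)
        also have "\<dots> = ennreal (c / 2) * ennreal (2 * half_conv_ratio v * p v)"
          using \<open>1 < c\<close> by (intro ennreal_mult') auto
        finally show "ennreal (p v) \<le> ennreal (c / 2) * self_conv v"
          using W[OF \<open>v \<in> ?W\<close>] by (simp add: self_conv_eq)
      qed (use fin \<open>1 < c\<close> in auto)
      ultimately have
        "dist (measure (density lborel self_conv) ?W / (2 * measure distr_p ?W)) 1 \<le> e / 2"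
        using \<open>0 < e\<close> elim
        by (intro dist_ratio_one_le) (auto simp: c_def measure_window_pos d algebra_simps)
      then show ?case
        unfolding lp lq unfolding convolution_distr_p using \<open>0 < e\<close> by simp
    qed
  qed
  then show "local_prob (distr_p \<star> distr_p) d \<sim>[at_top] (\<lambda>x. 2 * local_prob distr_p d x)"
    by (rule asymp_equivI')
qed

section \<open>Jumps of the density as jumps of the local probabilities\<close>

lemma local_prob_comparable:
  assumes "0 < d"
  shows "\<forall>\<^sub>F x in at_top. d / 2 * p x \<le> local_prob distr_p (ereal d) x \<and>
    local_prob distr_p (ereal d) x \<le> 2 * d * p x"
proof -
  obtain X where X: "\<And>x s. X \<le> x \<Longrightarrow> \<bar>s\<bar> \<le> d \<Longrightarrow> p (x + s) \<le> 2 * p x"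
    using long_tailed[OF assms, of 1] by (auto simp: eventually_at_top_linorder)
  show ?thesis
    using eventually_ge_at_top[of "max X 0"]
  proof eventually_elim
    case (elim x)
    \<comment> \<open>The second bound shifts back from \<open>v\<close> to \<open>x\<close>; the
      factor 2 is \<open>1 + e\<close> with \<open>e = 1\<close>.\<close>
    have v: "p v \<le> 2 * p x" "p x \<le> 2 * p v" if "v \<in> {x<..x + d}" for v
      using X[of x "v - x"] X[of v "x - v"] that elim by auto
    have pos: "0 < p x"
      using elim by (intro p_pos) auto
    have "local_prob distr_p (ereal d) x = measure distr_p {x<..x + d}"
      using assms local_prob_eq_measure_window[OF real_distribution_distr_p, of "ereal d"]
      by (simp add: window_ereal)
    moreover have "emeasure distr_p {x<..x + d}
        \<le> (\<integral>\<^sup>+v. ennreal (2 * p x) * indicator {x<..x + d} v \<partial>lborel)"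
      unfolding distr_p_def using v
      by (subst emeasure_density) (auto intro!: nn_integral_mono ennreal_leI split: split_indicator)
    moreover have "(\<integral>\<^sup>+v. ennreal (p x / 2) * indicator {x<..x + d} v \<partial>lborel)
        \<le> emeasure distr_p {x<..x + d}"
      unfolding distr_p_def using v
      by (subst emeasure_density)
         (auto intro!: nn_integral_mono ennreal_leI split: split_indicator simp: field_simps)
    ultimately show ?case
      using assms pos
      by (simp add: nn_integral_cmult_indicator ennreal_mult[symmetric] mult_ac
        finite_measure.emeasure_eq_measure[OF finite_measure_distr_p] measure_nonneg
        del: ennreal_numeral)
  qed
qed

text \<open>By \<open>local_prob_comparable\<close>, a quotient of local probabilities is far out at
  least a quarter of the quotient of the densities, so unbounded upward jumps of \<open>p\<close>
  suffice.\<close>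

lemma not_almost_decreased_distr_p:
  assumes "0 < d"
    and jump: "\<And>X B. \<exists>x y. X \<le> x \<and> x \<le> y \<and> B * p x \<le> p y"
  shows "\<not> almost_decreased distr_p (ereal d)"
proof
  assume "almost_decreased distr_p (ereal d)"
  then obtain x0 where "(SUP (x, y) \<in> {(x, y). x0 \<le> x \<and> x \<le> y}.
      ereal (local_prob distr_p (ereal d) y) / ereal (local_prob distr_p (ereal d) x)) < \<infinity>"
    unfolding almost_decreased_def by auto
  then obtain n :: nat where n: "(SUP (x, y) \<in> {(x, y). x0 \<le> x \<and> x \<le> y}.
      ereal (local_prob distr_p (ereal d) y) / ereal (local_prob distr_p (ereal d) x)) < ereal n"
    using less_PInf_Ex_of_nat[THEN iffD1, OF less_imp_neq] by blast
  define B where "B = real n"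
  have B: "ereal (local_prob distr_p (ereal d) y) / ereal (local_prob distr_p (ereal d) x) \<le> ereal B"
    if "x0 \<le> x" "x \<le> y" for x y
    using less_imp_le[OF n] that unfolding SUP_le_iff B_def by auto
  obtain X where X: "\<And>x. X \<le> x \<Longrightarrow> d / 2 * p x \<le> local_prob distr_p (ereal d) x"
      "\<And>x. X \<le> x \<Longrightarrow> local_prob distr_p (ereal d) x \<le> 2 * d * p x"
    using local_prob_comparable[OF assms(1)] by (auto simp: eventually_at_top_linorder)
  \<comment> \<open>The factor 4 is the quotient of \<open>2 * d\<close> and \<open>d / 2\<close>;
    the added 4 makes the final contradiction strict.\<close>
  obtain x y where xy: "max (max X 0) x0 \<le> x" "x \<le> y" "(4 * \<bar>B\<bar> + 4) * p x \<le> p y"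
    using jump by blast
  let ?a = "local_prob distr_p (ereal d) x" and ?b = "local_prob distr_p (ereal d) y"
  have "0 < p x"
    using xy by (intro p_pos) auto
  then have "0 < d / 2 * p x"
    using \<open>0 < d\<close> by simp
  also have "\<dots> \<le> ?a"
    using X(1) xy by auto
  finally have "0 < ?a" .
  have "ereal ?b / ereal ?a \<le> ereal B"
    using xy by (intro B) auto
  then have "?b \<le> B * ?a"
    using \<open>0 < ?a\<close> by (simp add: field_simps)
  also have "\<dots> \<le> \<bar>B\<bar> * (2 * d * p x)"
    using X(2)[of x] xy \<open>0 < ?a\<close> by (intro mult_mono) auto
  also have "\<dots> = d / 2 * (4 * \<bar>B\<bar> * p x)"
    by simp
  also have "\<dots> < d / 2 * ((4 * \<bar>B\<bar> + 4) * p x)"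
    using \<open>0 < p x\<close> \<open>0 < d\<close> by (intro mult_strict_left_mono) (auto simp: algebra_simps)
  also have "\<dots> \<le> d / 2 * p y"
    using xy \<open>0 < d\<close> by (intro mult_left_mono) auto
  also have "\<dots> \<le> ?b"
    using X(1)[of y] xy by auto
  finally show False
    by simp
qed

end

section \<open>An oscillating density\<close>

text \<open>Between consecutive powers of 4 the slope is first \<open>2 + 3 = 5\<close> and then
  \<open>2 - 3 = -1\<close>. The term \<open>2 * u\<close> secures integrability, and the larger
  coefficient 3 produces the descents.\<close>

definition oscillation :: "real \<Rightarrow> real" where
  "oscillation u = 2 * u + 3 * infdist u (range (\<lambda>k::nat. 4 ^ k))"

lemma oscillation_ge: "2 * u \<le> oscillation u"
  by (simp add: oscillation_def infdist_nonneg)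

lemma oscillation_lipschitz: "\<bar>oscillation u - oscillation v\<bar> \<le> 5 * \<bar>u - v\<bar>"
  using infdist_triangle_abs[of u "range (\<lambda>k::nat. 4 ^ k)" v]
  by (auto simp: oscillation_def dist_real_def abs_if split: if_splits)

text \<open>The point \<open>3 * 4 ^ k\<close> is past the midpoint \<open>5 / 2 * 4 ^ k\<close>, at
  distance \<open>4 ^ k\<close> from the set of powers, so the two values are
  \<open>9 * 4 ^ k\<close> and \<open>8 * 4 ^ k\<close>.\<close>

lemma oscillation_drop: "oscillation (4 ^ Suc k) + 4 ^ k \<le> oscillation (3 * 4 ^ k)"
proof -
  have "4 ^ k \<le> infdist (3 * 4 ^ k :: real) (range (\<lambda>j::nat. 4 ^ j))"
  proof (subst infdist_notempty, simp, rule cINF_greatest, simp)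
    fix a :: real assume "a \<in> range (\<lambda>j::nat. 4 ^ j)"
    then obtain j :: nat where a: "a = 4 ^ j" by auto
    show "4 ^ k \<le> dist (3 * 4 ^ k) a"
    proof (cases "j \<le> k")
      case True
      then have "a \<le> 4 ^ k"
        unfolding a by (intro power_increasing) auto
      then show ?thesis
        by (simp add: dist_real_def)
    next
      case False
      then have "4 ^ Suc k \<le> a"
        unfolding a by (intro power_increasing) auto
      then show ?thesis
        by (simp add: dist_real_def)
    qed
  qed
  moreover have "infdist (4 ^ Suc k :: real) (range (\<lambda>j::nat. 4 ^ j)) = 0"
    by (rule infdist_zero) blast
  ultimately show ?thesis
    by (simp add: oscillation_def)
qed

section \<open>The unnormalised density in the logarithmic coordinate\<close>

definition osc_density :: "real \<Rightarrow> real" where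
  "osc_density x = (if x < 0 then 0 else exp (- oscillation (ln (1 + x))))"

lemma osc_density_measurable [measurable]: "osc_density \<in> borel_measurable borel"
proof -
  have [measurable]: "oscillation \<in> borel_measurable borel"
    unfolding oscillation_def by (intro borel_measurable_continuous_onI continuous_intros)
  show ?thesis
    unfolding osc_density_def by measurable
qed

text \<open>The Lipschitz constant 5 becomes a multiplicative bound, the common source of
  \<open>osc_density_long_tailed\<close> and \<open>osc_density_dominated\<close>.\<close>

lemma osc_density_le:
  assumes "0 \<le> x" "0 \<le> z"
  shows "osc_density z \<le> exp (5 * \<bar>ln (1 + x) - ln (1 + z)\<bar>) * osc_density x"
  using oscillation_lipschitz[of "ln (1 + x)" "ln (1 + z)"] assms
  by (simp add: osc_density_def exp_add[symmetric])

text \<open>By \<open>oscillation_ge\<close> the density is at most \<open>1 / (1 + x) ^ 2\<close>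
  on the half-line.\<close>

lemma nn_integral_osc_density_finite: "(\<integral>\<^sup>+x. ennreal (osc_density x) \<partial>lborel) < \<infinity>"
proof -
  have "(\<integral>\<^sup>+x. ennreal (osc_density x) \<partial>lborel)
      \<le> (\<integral>\<^sup>+x. ennreal (1 / (1 + x)\<^sup>2) * indicator {0..} x \<partial>lborel)"
  proof (intro nn_integral_mono)
    fix x :: real
    show "ennreal (osc_density x) \<le> ennreal (1 / (1 + x)\<^sup>2) * indicator {0..} x"
    proof (cases "0 \<le> x")
      case True
      then have "osc_density x \<le> exp (- (2 * ln (1 + x)))"
        using oscillation_ge[of "ln (1 + x)"] by (simp add: osc_density_def)
      also have "\<dots> = 1 / (1 + x)\<^sup>2"
        using True by (simp add: exp_minus exp_double inverse_eq_divide)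
      finally show ?thesis
        using True by (simp add: ennreal_leI)
    qed (simp add: osc_density_def)
  qed
  also have "\<dots> = ennreal (0 - (- 1 / (1 + 0)))"
  proof (rule nn_integral_FTC_atLeast)
    show "((\<lambda>x::real. - 1 / (1 + x)) has_real_derivative 1 / (1 + x)\<^sup>2) (at x)" if "0 \<le> x" for x
      using that by (auto intro!: derivative_eq_intros simp: power2_eq_square)
    show "((\<lambda>x::real. - 1 / (1 + x)) \<longlongrightarrow> 0) at_top"
      by (intro tendsto_divide_0[OF tendsto_const] filterlim_at_top_imp_at_infinity
          filterlim_tendsto_add_at_top[OF tendsto_const] filterlim_ident)
  qed auto
  finally show ?thesis
    by (simp add: le_less_trans)
qed

lemma nn_integral_osc_density_pos: "0 < (\<integral>\<^sup>+x. ennreal (osc_density x) \<partial>lborel)"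
proof (rule ccontr)
  assume "\<not> ?thesis"
  then have "AE x in lborel. ennreal (osc_density x) = 0"
    by (subst (asm) not_gr_zero, subst (asm) nn_integral_0_iff_AE) auto
  then have "AE x in lborel. x \<notin> {0..1::real}"
    by eventually_elim (auto simp: osc_density_def ennreal_eq_0_iff)
  then have "emeasure lborel {0..1::real} = 0"
    by (subst (asm) AE_iff_measurable[where N = "{0..1}"]) auto
  then show False
    by simp
qed

text \<open>A shift by at most \<open>t\<close> moves \<open>ln (1 + x)\<close> by at most
  \<open>t / (x - t)\<close>, which tends to 0.\<close>

lemma osc_density_long_tailed:
  assumes "0 < t" "0 < e"
  shows "\<forall>\<^sub>F x in at_top. \<forall>s. \<bar>s\<bar> \<le> t \<longrightarrow> osc_density (x + s) \<le> (1 + e) * osc_density x"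
proof -
  have "filterlim (\<lambda>x. - t + x) at_top at_top"
    by (intro filterlim_tendsto_add_at_top[OF tendsto_const] filterlim_ident)
  then have "((\<lambda>x. t / (x - t)) \<longlongrightarrow> 0) at_top"
    by (intro tendsto_divide_0[OF tendsto_const] filterlim_at_top_imp_at_infinity) simp
  then have "((\<lambda>x. exp (5 * (t / (x - t)))) \<longlongrightarrow> exp (5 * 0)) at_top"
    by (intro tendsto_intros)
  then have "\<forall>\<^sub>F x in at_top. exp (5 * (t / (x - t))) < 1 + e"
    by (rule order_tendstoD) (use assms in simp)
  then show ?thesis
    using eventually_gt_at_top[of t]
  proof eventually_elim
    case (elim x)
    show ?case
    proof (intro allI impI)
      fix s :: real assume s: "\<bar>s\<bar> \<le> t"
      \<comment> \<open>This is stated for general \<open>a\<close> and \<open>b\<close> so that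
        exchanging \<open>1 + x\<close> and \<open>1 + (x + s)\<close> bounds the absolute
        value.\<close>
      have *: "ln b - ln a \<le> t / (x - t)" if "x - t \<le> a" "b \<le> a + t" "0 < b" for a b
      proof -
        have "ln b - ln a \<le> (b - a) / a"
          using ln_diff_le[of b a] that elim by auto
        also have "\<dots> \<le> t / (x - t)"
          using that elim assms by (intro frac_le) auto
        finally show ?thesis .
      qed
      have "\<bar>ln (1 + x) - ln (1 + (x + s))\<bar> \<le> t / (x - t)"
        using *[of "1 + x" "1 + (x + s)"] *[of "1 + (x + s)" "1 + x"] s elim assms
        by (auto simp: abs_le_iff)
      then have "exp (5 * \<bar>ln (1 + x) - ln (1 + (x + s))\<bar>) \<le> exp (5 * (t / (x - t)))"
        by simp
      also have "\<dots> \<le> 1 + e"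
        using elim by simp
      finally have "exp (5 * \<bar>ln (1 + x) - ln (1 + (x + s))\<bar>) * osc_density x
          \<le> (1 + e) * osc_density x"
        by (intro mult_right_mono) (auto simp: osc_density_def)
      then show "osc_density (x + s) \<le> (1 + e) * osc_density x"
        using s elim assms by (intro order_trans[OF osc_density_le[of x "x + s"]]) auto
    qed
  qed
qed

text \<open>From \<open>x \<le> 2 * z\<close> follows \<open>1 + x \<le> 2 * (1 + z)\<close>, so the
  logarithmic coordinates differ by at most \<open>ln 2\<close>. The constant equals
  \<open>2 ^ 5\<close>.\<close>

lemma osc_density_dominated:
  assumes "0 \<le> x" "x / 2 \<le> z" "z \<le> x"
  shows "osc_density z \<le> exp (5 * ln 2) * osc_density x"
proof -
  have "ln (1 + x) \<le> ln (2 * (1 + z))"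
    using assms by simp
  also have "\<dots> = ln 2 + ln (1 + z)"
    using assms by (intro ln_mult_pos) auto
  finally have "\<bar>ln (1 + x) - ln (1 + z)\<bar> \<le> ln 2"
    using assms by (simp add: abs_le_iff)
  then have "exp (5 * \<bar>ln (1 + x) - ln (1 + z)\<bar>) * osc_density x
      \<le> exp (5 * ln 2) * osc_density x"
    by (intro mult_right_mono) (auto simp: osc_density_def)
  then show ?thesis
    using osc_density_le[of x z] assms by simp
qed

lemma osc_density_jump: "\<exists>x y. X \<le> x \<and> x \<le> y \<and> B * osc_density x \<le> osc_density y"
proof -
  obtain k :: nat where "max B X < 4 ^ k"
    using real_arch_pow[of 4 "max B X"] by auto
  then have k: "B \<le> 4 ^ k" "X \<le> 4 ^ k"
    by auto
  \<comment> \<open>In the coordinate \<open>ln (1 + x)\<close> these are the two points of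
    \<open>oscillation_drop\<close>, so the density grows by a factor of at least
    \<open>exp (4 ^ k)\<close>.\<close>
  define x y where "x = exp (3 * 4 ^ k) - (1::real)" and "y = exp (4 ^ Suc k) - (1::real)"
  have "X \<le> x"
    using k(2) exp_ge_add_one_self[of "3 * 4 ^ k"] zero_le_power[of "4::real" k]
    unfolding x_def by linarith
  moreover have "x \<le> y"
    by (simp add: x_def y_def)
  moreover have "B * osc_density x \<le> osc_density y"
  proof -
    have "B \<le> exp (4 ^ k)"
      using k(1) exp_ge_add_one_self[of "4 ^ k"] by linarith
    then have "B * osc_density x \<le> exp (4 ^ k) * osc_density x"
      by (intro mult_right_mono) (auto simp: osc_density_def)
    also have "\<dots> = exp (4 ^ k - oscillation (3 * 4 ^ k))"
      by (simp add: osc_density_def x_def exp_add[symmetric])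
    also have "\<dots> \<le> exp (- oscillation (4 ^ Suc k))"
      using oscillation_drop[of k] by simp
    also have "\<dots> = osc_density y"
      by (simp add: osc_density_def y_def)
    finally show ?thesis .
  qed
  ultimately show ?thesis
    by blast
qed

section \<open>Normalisation and conclusion\<close>

theorem mainTheorem2:
  shows "\<exists>F :: real measure.
    distribution_on_nonneg F \<and> S_loc F \<and>
    (\<forall>d::real. 0 < d \<longrightarrow> \<not> almost_decreased F (ereal d))"
proof -
  obtain c where c: "0 < c" "(\<integral>\<^sup>+x. ennreal (osc_density x) \<partial>lborel) = ennreal c"
    using nn_integral_osc_density_finite nn_integral_osc_density_pos
    by (cases "\<integral>\<^sup>+x. ennreal (osc_density x) \<partial>lborel") auto
  define p where "p = (\<lambda>x. osc_density x / c)"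
  \<comment> \<open>With \<open>K\<close> inside the quotient, each inequality for
    \<open>osc_density\<close> passes to \<open>p\<close> on division by \<open>c\<close>, its
    constants unchanged.\<close>
  have scale: "K * p x = (K * osc_density x) / c" for K x
    by (simp add: p_def)
  interpret long_tailed_density p "exp (5 * ln 2)"
  proof
    show "p \<in> borel_measurable borel"
      unfolding p_def by measurable
    show "p x = 0" if "x < 0" for x
      using that by (simp add: p_def osc_density_def)
    show "0 < p x" if "0 \<le> x" for x
      using that c by (simp add: p_def osc_density_def)
    have "(\<integral>\<^sup>+x. ennreal (p x) \<partial>lborel) = (\<integral>\<^sup>+x. ennreal (osc_density x) * ennreal (1 / c) \<partial>lborel)"
      using c by (intro nn_integral_cong) (auto simp: p_def osc_density_def ennreal_mult[symmetric])
    then show "(\<integral>\<^sup>+x. ennreal (p x) \<partial>lborel) = 1"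
      using c by (simp add: nn_integral_multc ennreal_mult[symmetric])
    show "\<forall>\<^sub>F x in at_top. \<forall>s. \<bar>s\<bar> \<le> t \<longrightarrow> p (x + s) \<le> (1 + e) * p x" if "0 < t" "0 < e" for t e
      using osc_density_long_tailed[OF that] c
      unfolding scale unfolding p_def
      by (elim eventually_mono) (auto intro!: divide_right_mono)
    show "p z \<le> exp (5 * ln 2) * p x" if "0 \<le> x" "x / 2 \<le> z" "z \<le> x" for x z
      using osc_density_dominated[OF that] c by (auto simp: scale p_def intro!: divide_right_mono)
  qed
  have "\<exists>x y. X \<le> x \<and> x \<le> y \<and> B * p x \<le> p y" for X B
    using osc_density_jump[of X B] c unfolding scale unfolding p_def
    by (meson divide_right_mono less_imp_le)
  then show ?thesis
    using distribution_on_nonneg_distr_p S_loc_distr_p not_almost_decreased_distr_p by blast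
qed

end
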